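(* Let $\mathbb A$ be a graph of groups whose underlying graph $A$ is not a tree, and let $G=\pi_1(\mathbb A)$. Suppose that $(x,y)$ and $(x',y')$ are generating pairs of $G$ such that $x$ and $x'$ are elliptic. Then $(x,y)$ and $(x',y')$ are Nielsen equivalent if and only if there exist $g\in G$, $k\in\mathbb Z$ and $\varepsilon,\eta\in\{-1,1\}$ such that $$x'=gx^{\varepsilon}g^{-1}\quad\text{and}\quad y'=gy^{\eta}x^{k}g^{-1}.$$
   Context: Graphs of groups are in the sense of Bass–Serre theory, with connected underlying graph; $\pi_1(\mathbb A)$ is the fundamental group of the graph of groups. An element of $\pi_1(\mathbb A)$ is elliptic if it is conjugate to an element of one of the vertex groups. Nielsen equivalence: for a group $G$, two $k$-tuples $(g_1,\ldots,g_k)$ and $(h_1,\ldots,h_k)$ of elements of $G$ are elementarily equivalent if one of the following holds: (1) $h_i=g_{\sigma(i)}$ for all $i$ and some permutation $\sigma\in S_k$; (2) $h_i=g_i^{-1}$ for some $i$ and $h_j=g_j$ for all $j\ne i$; (3) $h_i=g_ig_j^{\varepsilon}$ for some $i\ne j$ and $\varepsilon\in\{-1,1\}$, and $h_l=g_l$ for all $l\neq i$. Two tuples are Nielsen equivalent if one can be transformed into the other by a finite sequence of elementary equivalences. A generating pair of $G$ is a pair $(x,y)$ of elements with $G=\langle x,y\rangle$. *)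

theory Defs
  imports
    "Graph_Theory.Graph_Theory"
    "HOL-Algebra.Generated_Groups"
    "HOL-Combinatorics.Permutations"
begin

section \<open>Trees\<close>

text \<open>Graphs are graphs in the sense of Serre: every geometric edge is a pair of mutually inverse
  oriented edges, so a graph is a bidirected digraph together with its fixed-point free involution
  on arcs. The library's \<^const>\<open>tree\<close> cannot be used here, because it counts the closed
  walk consisting of an arc and its inverse as a cycle. A circuit is therefore required to have no
  backtracking; this only matters for cycles of length two.\<close>

definition circuit :: "('v, 'e) pre_digraph \<Rightarrow> ('e \<Rightarrow> 'e) \<Rightarrow> 'e list \<Rightarrow> bool" where
  "circuit \<Gamma> rv p \<longleftrightarrow> pre_digraph.cycle \<Gamma> p \<and> successively (\<lambda>e f. f \<noteq> rv e) p"

definition serre_tree :: "('v, 'e) pre_digraph \<Rightarrow> ('e \<Rightarrow> 'e) \<Rightarrow> bool" where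
  "serre_tree \<Gamma> rv \<longleftrightarrow> Digraph_Component.connected \<Gamma> \<and> (\<nexists>p. circuit \<Gamma> rv p)"

section \<open>Graphs of groups\<close>

text \<open>\<open>emb A e\<close> is the boundary monomorphism from the group of \<open>e\<close> into the group of the
  tail of \<open>e\<close>; the one into the group of the head is \<open>emb A (einv A e)\<close>.\<close>

record ('v, 'e, 'a, 'c) gog =
  ugraph :: "('v, 'e) pre_digraph"
  einv :: "'e \<Rightarrow> 'e"
  vgrp :: "'v \<Rightarrow> 'a monoid"
  egrp :: "'e \<Rightarrow> 'c monoid"
  emb :: "'e \<Rightarrow> 'c \<Rightarrow> 'a"

locale graph_of_groups =
  fixes A :: "('v, 'e, 'a, 'c) gog"
  assumes bidirected: "bidirected_digraph (ugraph A) (einv A)"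
    and connected: "Digraph_Component.connected (ugraph A)"
    and vgrp_group: "v \<in> verts (ugraph A) \<Longrightarrow> group (vgrp A v)"
    and egrp_group: "e \<in> arcs (ugraph A) \<Longrightarrow> group (egrp A e)"
    and egrp_einv: "e \<in> arcs (ugraph A) \<Longrightarrow> egrp A (einv A e) = egrp A e"
    and emb_hom: "e \<in> arcs (ugraph A) \<Longrightarrow>
      emb A e \<in> hom (egrp A e) (vgrp A (tail (ugraph A) e))"
    and emb_inj: "e \<in> arcs (ugraph A) \<Longrightarrow> inj_on (emb A e) (carrier (egrp A e))"

section \<open>The fundamental group\<close>

text \<open>The path $a_0, e_1, a_1, \ldots, e_k, a_k$ is encoded as
  \<open>(a\<^sub>0, [(e\<^sub>1, a\<^sub>1), \<dots>, (e\<^sub>k, a\<^sub>k)])\<close>.\<close>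

type_synonym ('e, 'a) gpath = "'a \<times> ('e \<times> 'a) list"

fun gog_path :: "('v, 'e, 'a, 'c) gog \<Rightarrow> 'v \<Rightarrow> ('e, 'a) gpath \<Rightarrow> 'v \<Rightarrow> bool" where
  "gog_path A u (a, []) v \<longleftrightarrow>
    u \<in> verts (ugraph A) \<and> a \<in> carrier (vgrp A u) \<and> u = v"
| "gog_path A u (a, (e, b) # es) v \<longleftrightarrow>
    a \<in> carrier (vgrp A u) \<and> e \<in> arcs (ugraph A) \<and> tail (ugraph A) e = u \<and>
    gog_path A (head (ugraph A) e) (b, es) v"

text \<open>In \<open>path_mult A w p q\<close> the vertex \<open>w\<close> is the end of \<open>p\<close> and the start of \<open>q\<close>.\<close>

fun path_mult ::
  "('v, 'e, 'a, 'c) gog \<Rightarrow> 'v \<Rightarrow> ('e, 'a) gpath \<Rightarrow> ('e, 'a) gpath \<Rightarrow> ('e, 'a) gpath" where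
  "path_mult A w (a, []) (b, fs) = (a \<otimes>\<^bsub>vgrp A w\<^esub> b, fs)"
| "path_mult A w (a, (e, b) # es) q =
    (a, (e, fst (path_mult A w (b, es) q)) # snd (path_mult A w (b, es) q))"

text \<open>In \<open>path_inv A u p\<close> the vertex \<open>u\<close> is the start of \<open>p\<close>.\<close>

fun path_inv :: "('v, 'e, 'a, 'c) gog \<Rightarrow> 'v \<Rightarrow> ('e, 'a) gpath \<Rightarrow> ('e, 'a) gpath" where
  "path_inv A u (a, []) = (inv\<^bsub>vgrp A u\<^esub> a, [])"
| "path_inv A u (a, (e, b) # es) =
    path_mult A (head (ugraph A) e) (path_inv A (head (ugraph A) e) (b, es))
      (\<one>\<^bsub>vgrp A (head (ugraph A) e)\<^esub>, [(einv A e, inv\<^bsub>vgrp A u\<^esub> a)])"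

text \<open>\<open>path_equiv A u v p q\<close>: the paths \<open>p\<close> and \<open>q\<close> from \<open>u\<close> to \<open>v\<close> are equivalent, for the
  congruence generated by $a, e, b \sim a\,\alpha_e(c), e, \omega_e(c)^{-1} b$ and
  $a, e, 1, e^{-1}, b \sim ab$.\<close>

inductive path_equiv ::
  "('v, 'e, 'a, 'c) gog \<Rightarrow> 'v \<Rightarrow> 'v \<Rightarrow> ('e, 'a) gpath \<Rightarrow> ('e, 'a) gpath \<Rightarrow> bool"
  for A :: "('v, 'e, 'a, 'c) gog" where
  refl: "gog_path A u p v \<Longrightarrow> path_equiv A u v p p"
| sym: "path_equiv A u v p q \<Longrightarrow> path_equiv A u v q p"
| trans: "path_equiv A u v p q \<Longrightarrow> path_equiv A u v q r \<Longrightarrow> path_equiv A u v p r"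
| cong: "path_equiv A u w p p' \<Longrightarrow> path_equiv A w v q q' \<Longrightarrow>
    path_equiv A u v (path_mult A w p q) (path_mult A w p' q')"
| slide: "e \<in> arcs (ugraph A) \<Longrightarrow> tail (ugraph A) e = u \<Longrightarrow> head (ugraph A) e = v \<Longrightarrow>
    a \<in> carrier (vgrp A u) \<Longrightarrow> b \<in> carrier (vgrp A v) \<Longrightarrow> c \<in> carrier (egrp A e) \<Longrightarrow>
    path_equiv A u v (a, [(e, b)])
      (a \<otimes>\<^bsub>vgrp A u\<^esub> emb A e c,
        [(e, inv\<^bsub>vgrp A v\<^esub> (emb A (einv A e) c) \<otimes>\<^bsub>vgrp A v\<^esub> b)])"
| cancel: "e \<in> arcs (ugraph A) \<Longrightarrow> tail (ugraph A) e = u \<Longrightarrow> head (ugraph A) e = v \<Longrightarrow>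
    a \<in> carrier (vgrp A u) \<Longrightarrow> b \<in> carrier (vgrp A u) \<Longrightarrow>
    path_equiv A u u (a, [(e, \<one>\<^bsub>vgrp A v\<^esub>), (einv A e, b)]) (a \<otimes>\<^bsub>vgrp A u\<^esub> b, [])"

definition path_class ::
  "('v, 'e, 'a, 'c) gog \<Rightarrow> 'v \<Rightarrow> 'v \<Rightarrow> ('e, 'a) gpath \<Rightarrow> ('e, 'a) gpath set" where
  "path_class A u v p = {q. path_equiv A u v p q}"

definition fundamental_group ::
  "('v, 'e, 'a, 'c) gog \<Rightarrow> 'v \<Rightarrow> ('e, 'a) gpath set monoid" where
  "fundamental_group A v\<^sub>0 =
    \<lparr>carrier = {path_class A v\<^sub>0 v\<^sub>0 p | p. gog_path A v\<^sub>0 p v\<^sub>0},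
     monoid.mult = (\<lambda>X Y. \<Union>p\<in>X. \<Union>q\<in>Y. path_class A v\<^sub>0 v\<^sub>0 (path_mult A v\<^sub>0 p q)),
     one = path_class A v\<^sub>0 v\<^sub>0 (\<one>\<^bsub>vgrp A v\<^sub>0\<^esub>, [])\<rparr>"

text \<open>The group of the vertex \<open>v\<close> is identified with a subgroup of the fundamental group based at
  \<open>v\<^sub>0\<close> by means of a path \<open>p\<close> from \<open>v\<^sub>0\<close> to \<open>v\<close>, via $a \mapsto [p\,a\,p^{-1}]$. Changing \<open>p\<close>
  replaces this subgroup by a conjugate.\<close>

definition vertex_subgroup ::
  "('v, 'e, 'a, 'c) gog \<Rightarrow> 'v \<Rightarrow> 'v \<Rightarrow> ('e, 'a) gpath \<Rightarrow> ('e, 'a) gpath set set" where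
  "vertex_subgroup A v\<^sub>0 v p =
    (\<lambda>a. path_class A v\<^sub>0 v\<^sub>0 (path_mult A v (path_mult A v p (a, [])) (path_inv A v\<^sub>0 p)))
      ` carrier (vgrp A v)"

definition elliptic :: "('v, 'e, 'a, 'c) gog \<Rightarrow> 'v \<Rightarrow> ('e, 'a) gpath set \<Rightarrow> bool" where
  "elliptic A v\<^sub>0 x \<longleftrightarrow>
    (\<exists>v p. gog_path A v\<^sub>0 p v \<and>
      (\<exists>h \<in> vertex_subgroup A v\<^sub>0 v p. \<exists>g \<in> carrier (fundamental_group A v\<^sub>0).
        x = g \<otimes>\<^bsub>fundamental_group A v\<^sub>0\<^esub> h \<otimes>\<^bsub>fundamental_group A v\<^sub>0\<^esub> inv\<^bsub>fundamental_group A v\<^sub>0\<^esub> g))"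

section \<open>Nielsen equivalence\<close>

text \<open>A \<open>k\<close>-tuple is a list of length \<open>k\<close>, indexed from \<open>0\<close>.\<close>

inductive elementary_equiv :: "('g, 'b) monoid_scheme \<Rightarrow> 'g list \<Rightarrow> 'g list \<Rightarrow> bool"
  for G (structure) where
  permute: "\<sigma> permutes {..<length gs} \<Longrightarrow> elementary_equiv G gs (permute_list \<sigma> gs)"
| invert: "i < length gs \<Longrightarrow> elementary_equiv G gs (gs[i := inv (gs ! i)])"
| multiply: "i < length gs \<Longrightarrow> j < length gs \<Longrightarrow> i \<noteq> j \<Longrightarrow> \<epsilon> \<in> {-1, 1 :: int} \<Longrightarrow>
    elementary_equiv G gs (gs[i := gs ! i \<otimes> gs ! j [^] \<epsilon>])"

definition nielsen_equiv :: "('g, 'b) monoid_scheme \<Rightarrow> 'g list \<Rightarrow> 'g list \<Rightarrow> bool" where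
  "nielsen_equiv G = (elementary_equiv G)\<^sup>*\<^sup>*"

definition generating_pair :: "('g, 'b) monoid_scheme \<Rightarrow> 'g \<Rightarrow> 'g \<Rightarrow> bool" where
  "generating_pair G x y \<longleftrightarrow>
    x \<in> carrier G \<and> y \<in> carrier G \<and> generate G {x, y} = carrier G"

end

theory Submission
  imports Defs
begin

text \<open>Since the underlying graph has a circuit, counting the signed passages of a path through one of
  its edges gives a nonzero homomorphism \<open>\<phi>\<close> from \<open>G\<close> to the integers which vanishes on all elliptic
  elements. Run the Euclidean algorithm on a generating pair \<open>(g, h)\<close> by Nielsen moves that decrease
  \<open>\<bar>\<phi> g\<bar> + \<bar>\<phi> h\<bar>\<close> until one of the two values is \<open>0\<close>. Up to the relation in the theorem, the
  resulting pair is unchanged if \<open>(g, h)\<close> is replaced by an elementarily equivalent pair. As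
  \<open>\<phi> x = \<phi> x' = 0\<close>, the pairs \<open>(x, y)\<close> and \<open>(x', y')\<close> are already reduced. Conversely, conjugation by
  an element of \<open>G\<close> generated by \<open>x, y\<close> is a product of Nielsen moves.\<close>

section \<open>Nielsen equivalence of pairs\<close>

context group
begin

lemma inv_cancel_left:
  assumes "a \<in> carrier G" "b \<in> carrier G"
  shows "inv a \<otimes> (a \<otimes> b) = b" "a \<otimes> (inv a \<otimes> b) = b"
  using assms by (simp_all add: m_assoc [symmetric])

text \<open>With the default cancellation rules these form the complete rewriting system for free
  groups: for elements of the carrier, \<open>simp\<close> proves the word identities that hold in a
  free group.\<close>

lemmas word_simps = m_assoc inv_mult_group inv_cancel_left

text \<open>The relation of the theorem, read for fixed \<open>x\<close>, \<open>y\<close> as a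
  property of \<open>(g, h)\<close>. It is shown to be stable under simultaneous conjugation,
  inversion of either entry and multiplication of \<open>h\<close> by \<open>g\<close>. The entries
  play different roles, so their exchange is not among these moves.\<close>

definition twisted :: "'a \<Rightarrow> 'a \<Rightarrow> 'a \<Rightarrow> 'a \<Rightarrow> bool" where
  "twisted x y g h \<longleftrightarrow> (\<exists>u \<in> carrier G. \<exists>k :: int. \<exists>\<epsilon> \<in> {-1, 1 :: int}. \<exists>\<eta> \<in> {-1, 1 :: int}.
    g = u \<otimes> x [^] \<epsilon> \<otimes> inv u \<and> h = u \<otimes> y [^] \<eta> \<otimes> x [^] k \<otimes> inv u)"

lemma twistedI:
  assumes "u \<in> carrier G" "\<epsilon> \<in> {-1, 1 :: int}" "\<eta> \<in> {-1, 1 :: int}"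
    and "g = u \<otimes> x [^] \<epsilon> \<otimes> inv u" "h = u \<otimes> y [^] \<eta> \<otimes> x [^] (k :: int) \<otimes> inv u"
  shows "twisted x y g h"
  using assms unfolding twisted_def by blast

lemma twistedE:
  assumes "twisted x y g h"
  obtains u and k \<epsilon> \<eta> :: int where "u \<in> carrier G" "\<epsilon> \<in> {-1, 1}" "\<eta> \<in> {-1, 1}"
    "g = u \<otimes> x [^] \<epsilon> \<otimes> inv u" "h = u \<otimes> y [^] \<eta> \<otimes> x [^] k \<otimes> inv u"
  using assms unfolding twisted_def by blast

lemma int_pow_commute:
  assumes "x \<in> carrier G"
  shows "x [^] (i :: int) \<otimes> x [^] (j :: int) = x [^] j \<otimes> x [^] i"
  using assms by (simp add: int_pow_mult [symmetric] add.commute)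

context
  fixes x y
  assumes x [simp]: "x \<in> carrier G" and y [simp]: "y \<in> carrier G"
begin

lemma twisted_refl: "twisted x y x y"
  by (rule twistedI [of \<one> 1 1 _ _ _ _ 0]) simp_all

lemma twisted_conj:
  assumes "twisted x y g h" "c \<in> carrier G"
  shows "twisted x y (c \<otimes> g \<otimes> inv c) (c \<otimes> h \<otimes> inv c)"
proof -
  from assms(1) obtain u and k \<epsilon> \<eta> :: int where u: "u \<in> carrier G"
    "\<epsilon> \<in> {-1, 1}" "\<eta> \<in> {-1, 1}" "g = u \<otimes> x [^] \<epsilon> \<otimes> inv u"
    "h = u \<otimes> y [^] \<eta> \<otimes> x [^] k \<otimes> inv u"
    by (rule twistedE)
  show ?thesis
    by (rule twistedI [of "c \<otimes> u" \<epsilon> \<eta> _ _ _ _ k]) (use u assms(2) in \<open>simp_all add: word_simps\<close>)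
qed

lemma twisted_inv_left:
  assumes "twisted x y g h"
  shows "twisted x y (inv g) h"
proof -
  from assms obtain u and k \<epsilon> \<eta> :: int where u: "u \<in> carrier G"
    "\<epsilon> \<in> {-1, 1}" "\<eta> \<in> {-1, 1}" "g = u \<otimes> x [^] \<epsilon> \<otimes> inv u"
    "h = u \<otimes> y [^] \<eta> \<otimes> x [^] k \<otimes> inv u"
    by (rule twistedE)
  show ?thesis
    by (rule twistedI [of u "- \<epsilon>" \<eta> _ _ _ _ k]) (use u in \<open>auto simp: word_simps int_pow_neg\<close>)
qed

text \<open>In \<open>inv h\<close> the power of \<open>x\<close> stands on the wrong side of the
  power of \<open>y\<close>. Conjugation by a power of \<open>x\<close> carries it across and fixes
  \<open>x\<close>; hence the new conjugator \<open>u \<otimes> inv (x [^] k)\<close>.\<close>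

lemma twisted_inv_right:
  assumes "twisted x y g h"
  shows "twisted x y g (inv h)"
proof -
  from assms obtain u and k \<epsilon> \<eta> :: int where u: "u \<in> carrier G"
    "\<epsilon> \<in> {-1, 1}" "\<eta> \<in> {-1, 1}" "g = u \<otimes> x [^] \<epsilon> \<otimes> inv u"
    "h = u \<otimes> y [^] \<eta> \<otimes> x [^] k \<otimes> inv u"
    by (rule twistedE)
  have "x [^] \<epsilon> \<otimes> (x [^] k \<otimes> inv u) = x [^] k \<otimes> (x [^] \<epsilon> \<otimes> inv u)"
    using u(1) int_pow_commute [OF x, of \<epsilon> k] by (simp flip: m_assoc)
  then have comm: "inv (x [^] k) \<otimes> (x [^] \<epsilon> \<otimes> (x [^] k \<otimes> inv u)) = x [^] \<epsilon> \<otimes> inv u"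
    using u(1) by (simp add: inv_cancel_left)
  show ?thesis
  proof (rule twistedI [of "u \<otimes> inv (x [^] k)" \<epsilon> "- \<eta>" _ _ _ _ "- k"])
    show "g = u \<otimes> inv (x [^] k) \<otimes> x [^] \<epsilon> \<otimes> inv (u \<otimes> inv (x [^] k))"
      using u comm by (simp add: word_simps)
  qed (use u in \<open>auto simp: word_simps int_pow_neg\<close>)
qed

lemma twisted_mult:
  assumes "twisted x y g h"
  shows "twisted x y g (h \<otimes> g)"
proof -
  from assms obtain u and k \<epsilon> \<eta> :: int where u: "u \<in> carrier G"
    "\<epsilon> \<in> {-1, 1}" "\<eta> \<in> {-1, 1}" "g = u \<otimes> x [^] \<epsilon> \<otimes> inv u"
    "h = u \<otimes> y [^] \<eta> \<otimes> x [^] k \<otimes> inv u"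
    by (rule twistedE)
  show ?thesis
    by (rule twistedI [of u \<epsilon> \<eta> _ _ _ _ "k + \<epsilon>"])
      (use u in \<open>simp_all add: word_simps int_pow_mult\<close>)
qed

lemma twisted_inv_left_iff:
  "g \<in> carrier G \<Longrightarrow> twisted x y (inv g) h \<longleftrightarrow> twisted x y g h"
  using twisted_inv_left [of g h] twisted_inv_left [of "inv g" h] by auto

lemma twisted_inv_right_iff:
  "h \<in> carrier G \<Longrightarrow> twisted x y g (inv h) \<longleftrightarrow> twisted x y g h"
  using twisted_inv_right [of g h] twisted_inv_right [of g "inv h"] by auto

lemma twisted_mult_iff:
  assumes "g \<in> carrier G" "h \<in> carrier G"
  shows "twisted x y g (h \<otimes> g) \<longleftrightarrow> twisted x y g h"
proof
  assume "twisted x y g (h \<otimes> g)"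
  \<comment> \<open>Multiplication by \<open>inv g\<close> is multiplication by the first entry once
    that entry has been inverted.\<close>
  then have "twisted x y (inv g) (h \<otimes> g \<otimes> inv g)"
    using twisted_inv_left twisted_mult by blast
  then show "twisted x y g h"
    using assms by (simp add: twisted_inv_left_iff m_assoc)
qed (rule twisted_mult)

lemma twisted_conj_iff:
  assumes "g \<in> carrier G" "h \<in> carrier G" "c \<in> carrier G"
  shows "twisted x y (c \<otimes> g \<otimes> inv c) (c \<otimes> h \<otimes> inv c) \<longleftrightarrow> twisted x y g h"
proof
  assume "twisted x y (c \<otimes> g \<otimes> inv c) (c \<otimes> h \<otimes> inv c)"
  from twisted_conj [OF this, of "inv c"] show "twisted x y g h"
    using assms by (simp add: word_simps)
qed (use assms in \<open>blast intro: twisted_conj\<close>)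

section \<open>The Euclidean algorithm on pairs of group elements\<close>

text \<open>The Euclidean algorithm on a pair \<open>(g, h)\<close> whose images in the integers are \<open>m, n \<ge> 0\<close>; the
  value for \<open>m = n = 0\<close> is junk.\<close>

function reduces :: "nat \<Rightarrow> nat \<Rightarrow> 'a \<Rightarrow> 'a \<Rightarrow> bool" where
  "reduces m n g h \<longleftrightarrow>
    (if m = 0 \<and> n = 0 then True
     else if m = 0 then twisted x y g h
     else if n = 0 then twisted x y h g
     else if n \<le> m then reduces (m - n) n (g \<otimes> inv h) h
     else reduces m (n - m) g (h \<otimes> inv g))"
  by pat_completeness auto
termination
  by (relation "Wellfounded.measure (\<lambda>(m, n, g, h). m + n)") auto

declare reduces.simps [simp del]

lemma reduces_0_0 [simp]: "reduces 0 0 g h"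
  by (simp add: reduces.simps)

lemma reduces_0_left [simp]: "n > 0 \<Longrightarrow> reduces 0 n g h \<longleftrightarrow> twisted x y g h"
  by (simp add: reduces.simps)

lemma reduces_0_right [simp]: "m > 0 \<Longrightarrow> reduces m 0 g h \<longleftrightarrow> twisted x y h g"
  by (simp add: reduces.simps)

lemma reduces_ge: "0 < n \<Longrightarrow> n \<le> m \<Longrightarrow> reduces m n g h \<longleftrightarrow> reduces (m - n) n (g \<otimes> inv h) h"
  by (subst reduces.simps) simp

lemma reduces_less: "0 < m \<Longrightarrow> m < n \<Longrightarrow> reduces m n g h \<longleftrightarrow> reduces m (n - m) g (h \<otimes> inv g)"
  by (subst reduces.simps) simp

text \<open>Each step of the algorithm commutes with conjugation. This is used to compare runs that
  produce the same factors in a different order, such as \<open>h \<otimes> g\<close> and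
  \<open>g \<otimes> h\<close>.\<close>

lemma reduces_conj:
  assumes "g \<in> carrier G" "h \<in> carrier G" "c \<in> carrier G"
  shows "reduces m n (c \<otimes> g \<otimes> inv c) (c \<otimes> h \<otimes> inv c) \<longleftrightarrow> reduces m n g h"
  using assms
proof (induction m n g h rule: reduces.induct)
  case (1 m n g h)
  note c = 1(3-5)
  consider "m = 0" "n = 0" | "m = 0" "n > 0" | "m > 0" "n = 0" | "0 < n" "n \<le> m" | "0 < m" "m < n"
    by linarith
  then show ?case
  proof cases
    case 4
    have "c \<otimes> g \<otimes> inv c \<otimes> inv (c \<otimes> h \<otimes> inv c) = c \<otimes> (g \<otimes> inv h) \<otimes> inv c"
      using c by (simp add: word_simps)
    then show ?thesis
      using 4 1(1) c by (simp add: reduces_ge)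
  next
    case 5
    have "c \<otimes> h \<otimes> inv c \<otimes> inv (c \<otimes> g \<otimes> inv c) = c \<otimes> (h \<otimes> inv g) \<otimes> inv c"
      using c by (simp add: word_simps)
    then show ?thesis
      using 5 1(2) c by (simp add: reduces_less)
  qed (use c in \<open>simp_all add: twisted_conj_iff\<close>)
qed

text \<open>The two branches of the algorithm mirror each other except at a tie
  \<open>m = n > 0\<close>, which always goes to the branch that changes \<open>g\<close>. Only this
  case has content.\<close>

lemma reduces_swap:
  assumes "g \<in> carrier G" "h \<in> carrier G"
  shows "reduces m n g h \<longleftrightarrow> reduces n m h g"
  using assms
proof (induction m n g h rule: reduces.induct)
  case (1 m n g h)
  note c = 1(3-4)
  consider "m = 0" "n = 0" | "m = 0" "n > 0" | "m > 0" "n = 0" | "0 < n" "n < m" | "0 < m" "m < n"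
    | "m = n" "m > 0"
    by linarith
  then show ?case
  proof cases
    case 4
    then show ?thesis
      using 1(1) c by (simp add: reduces_ge reduces_less)
  next
    case 5
    then show ?thesis
      using 1(2) c by (simp add: reduces_ge reduces_less)
  next
    case 6
    \<comment> \<open>With \<open>d = g \<otimes> inv h\<close> the two runs end in
      \<open>(d, h)\<close> and \<open>(inv d, g)\<close>. Conjugation by \<open>d\<close> fixes
      \<open>d\<close> and turns \<open>h \<otimes> d\<close> into \<open>d \<otimes> h = g\<close>,
      so \<open>twisted_mult_iff\<close> connects them.\<close>
    have "twisted x y (g \<otimes> inv h) h \<longleftrightarrow> twisted x y (g \<otimes> inv h) (g \<otimes> inv h \<otimes> h)"
    proof -
      have "(g \<otimes> inv h) \<otimes> h = (g \<otimes> inv h) \<otimes> (h \<otimes> (g \<otimes> inv h)) \<otimes> inv (g \<otimes> inv h)"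
        "g \<otimes> inv h = (g \<otimes> inv h) \<otimes> (g \<otimes> inv h) \<otimes> inv (g \<otimes> inv h)"
        using c by (simp_all add: word_simps)
      then show ?thesis
        using c twisted_conj_iff [of "g \<otimes> inv h" "h \<otimes> (g \<otimes> inv h)" "g \<otimes> inv h"]
          twisted_mult_iff [of "g \<otimes> inv h" h] by simp
    qed
    also have "\<dots> \<longleftrightarrow> twisted x y (inv (g \<otimes> inv h)) g"
      using c by (subst twisted_inv_left_iff) (simp_all add: word_simps)
    finally show ?thesis
      using 6 c by (simp add: reduces_ge word_simps)
  qed simp_all
qed

end


section \<open>Invariance of the reduced pair under elementary equivalence\<close>

context
  fixes \<phi> :: "'a \<Rightarrow> int"
  assumes \<phi>_mult [simp]: "a \<in> carrier G \<Longrightarrow> b \<in> carrier G \<Longrightarrow> \<phi> (a \<otimes> b) = \<phi> a + \<phi> b"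
begin

lemma int_hom_one [simp]: "\<phi> \<one> = 0"
  using \<phi>_mult [of \<one> \<one>] by simp

lemma int_hom_inv [simp]:
  assumes "a \<in> carrier G"
  shows "\<phi> (inv a) = - \<phi> a"
  using \<phi>_mult [of "inv a" a] assms by simp

text \<open>Serves to show that a nonzero \<phi> vanishing on one entry of a generating pair is
  nonzero on the other.\<close>

lemma int_hom_eq_0_on_generate:
  assumes "S \<subseteq> carrier G" "\<And>a. a \<in> S \<Longrightarrow> \<phi> a = 0" "g \<in> generate G S"
  shows "\<phi> g = 0"
  using assms(3)
proof induction
  case (eng a b)
  then show ?case
    using generate_incl [OF assms(1)] by (auto simp: subset_iff)
qed (use assms in auto)

context
  fixes x y
  assumes x [simp]: "x \<in> carrier G" and y [simp]: "y \<in> carrier G"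
begin

text \<open>Normalises the sign, since \<open>reduces\<close> expects nonnegative images. Elements
  of the kernel of \<phi> stay as they are; their inverses are dealt with by
  \<open>twisted_inv_left_iff\<close>.\<close>

definition flip where
  "flip g = (if \<phi> g < 0 then inv g else g)"

text \<open>The invariant followed along a chain of Nielsen moves. If both images are 0, it holds by
  the junk value of \<open>reduces\<close>.\<close>

definition admissible where
  "admissible g h \<longleftrightarrow> reduces x y (nat \<bar>\<phi> g\<bar>) (nat \<bar>\<phi> h\<bar>) (flip g) (flip h)"

lemma flip_closed [simp]: "g \<in> carrier G \<Longrightarrow> flip g \<in> carrier G"
  by (simp add: flip_def)

lemma twisted_flip: "h \<in> carrier G \<Longrightarrow> twisted x y g (flip h) \<longleftrightarrow> twisted x y g h"
  by (simp add: flip_def twisted_inv_right_iff)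

lemma admissible_swap:
  assumes "g \<in> carrier G" "h \<in> carrier G"
  shows "admissible g h \<longleftrightarrow> admissible h g"
  using assms unfolding admissible_def by (intro reduces_swap) simp_all

lemma admissible_inv_left:
  assumes "g \<in> carrier G" "h \<in> carrier G"
  shows "admissible (inv g) h \<longleftrightarrow> admissible g h"
proof (cases "\<phi> g = 0")
  case True
  then show ?thesis
    using assms by (cases "\<phi> h = 0") (simp_all add: admissible_def flip_def twisted_inv_left_iff)
next
  case False
  then have "flip (inv g) = flip g"
    using assms by (auto simp: flip_def)
  then show ?thesis
    using assms by (simp add: admissible_def)
qed

lemma admissible_inv_right:
  assumes "g \<in> carrier G" "h \<in> carrier G"
  shows "admissible g (inv h) \<longleftrightarrow> admissible g h"
  using assms admissible_swap admissible_inv_left by (metis inv_closed)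

text \<open>The runs of the algorithm on the two pairs merge. If \<open>\<phi> g \<ge> 0\<close>,
  the first step from \<open>(g \<otimes> h, h)\<close> leads to \<open>(g, h)\<close>. If
  \<open>\<phi> (g \<otimes> h) \<le> 0\<close>, then \<open>g\<close> is flipped and the first step
  from \<open>(inv g, h)\<close> leads to a conjugate of \<open>(inv (g \<otimes> h), h)\<close>. In
  the remaining case each run takes one step.\<close>

lemma admissible_mult_pos:
  assumes g: "g \<in> carrier G" and h: "h \<in> carrier G" and pos: "\<phi> h > 0"
  shows "admissible (g \<otimes> h) h \<longleftrightarrow> admissible g h"
proof -
  define n where "n = nat (\<phi> h)"
  have n: "\<phi> h = int n" "n > 0"
    using pos by (simp_all add: n_def)
  have flip_h: "flip h = h"
    using pos by (simp add: flip_def)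
  consider (nonneg) "\<phi> g \<ge> 0" | (zero) "\<phi> g + \<phi> h = 0" | (neg) "\<phi> g + \<phi> h < 0"
    | (mixed) "\<phi> g < 0" "\<phi> g + \<phi> h > 0"
    by linarith
  then show ?thesis
  proof cases
    case nonneg
    then obtain m where m: "\<phi> g = int m"
      using nonneg_int_cases by blast
    show ?thesis
      using m n g h reduces_ge [OF x y, of n "m + n"]
      by (simp add: admissible_def flip_def nat_add_distrib m_assoc)
  next
    case zero
    have "admissible g h \<longleftrightarrow> twisted x y (inv g \<otimes> inv h) h"
      using zero n g h by (simp add: admissible_def flip_def reduces_ge)
    also have "\<dots> \<longleftrightarrow> twisted x y (inv h \<otimes> (inv g \<otimes> inv h) \<otimes> inv (inv h)) (inv h \<otimes> h \<otimes> inv (inv h))"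
      using g h by (subst twisted_conj_iff) simp_all
    also have "\<dots> \<longleftrightarrow> twisted x y (inv (g \<otimes> h)) h"
      using g h by (simp add: word_simps)
    \<comment> \<open>As \<open>\<phi> (g \<otimes> h) = 0\<close>, \<open>flip\<close> does not
      invert \<open>g \<otimes> h\<close>; the inverse is removed by the symmetry of
      \<open>twisted\<close> instead.\<close>
    also have "\<dots> \<longleftrightarrow> admissible (g \<otimes> h) h"
      using zero n g h by (simp add: admissible_def flip_def twisted_inv_left_iff)
    finally show ?thesis ..
  next
    case neg
    define m where "m = nat (- (\<phi> g + \<phi> h))"
    have m: "\<phi> g = - int (m + n)" "m > 0"
      using neg n by (simp_all add: m_def)
    have "admissible g h \<longleftrightarrow> reduces x y m n (inv g \<otimes> inv h) h"
      using m n g h by (simp add: admissible_def flip_def reduces_ge nat_add_distrib)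
    also have "\<dots> \<longleftrightarrow> reduces x y m n (inv h \<otimes> (inv g \<otimes> inv h) \<otimes> inv (inv h)) (inv h \<otimes> h \<otimes> inv (inv h))"
      using g h by (subst reduces_conj) simp_all
    also have "\<dots> \<longleftrightarrow> reduces x y m n (inv (g \<otimes> h)) h"
      using g h by (simp add: word_simps)
    also have "\<dots> \<longleftrightarrow> admissible (g \<otimes> h) h"
      using m n g h by (simp add: admissible_def flip_def)
    finally show ?thesis ..
  next
    case mixed
    define m where "m = nat (- \<phi> g)"
    define k where "k = nat (\<phi> g + \<phi> h)"
    have m: "\<phi> g = - int m" "m > 0" and k: "n = m + k" "k > 0"
      using mixed n by (simp_all add: m_def k_def nat_eq_iff)
    \<comment> \<open>One step leads from \<open>(inv g, h)\<close> to
      \<open>(inv g, h \<otimes> g)\<close> and from \<open>(g \<otimes> h, h)\<close> to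
      \<open>(g \<otimes> h, inv g)\<close>, with images \<open>m, k\<close> and
      \<open>k, m\<close>. Conjugating the former by \<open>g\<close> and exchanging its entries
      gives the latter.\<close>
    have "admissible g h \<longleftrightarrow> reduces x y m n (inv g) h"
      using m n g h by (simp add: admissible_def flip_def)
    also have "\<dots> \<longleftrightarrow> reduces x y m k (inv g) (h \<otimes> g)"
      using m k g h by (simp add: reduces_less)
    also have "\<dots> \<longleftrightarrow> reduces x y m k (g \<otimes> inv g \<otimes> inv g) (g \<otimes> (h \<otimes> g) \<otimes> inv g)"
      using g h by (subst reduces_conj) simp_all
    also have "\<dots> \<longleftrightarrow> reduces x y m k (inv g) (g \<otimes> h)"
      using g h by (simp add: word_simps)
    also have "\<dots> \<longleftrightarrow> reduces x y k m (g \<otimes> h) (inv g)"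
      using g h by (intro reduces_swap) simp_all
    also have "\<dots> \<longleftrightarrow> reduces x y k n (g \<otimes> h) h"
      using m k g h by (simp add: reduces_less word_simps)
    also have "\<dots> \<longleftrightarrow> admissible (g \<otimes> h) h"
      using m n k g h by (simp add: admissible_def flip_def nat_add_distrib)
    finally show ?thesis ..
  qed
qed

lemma admissible_mult:
  assumes g: "g \<in> carrier G" and h: "h \<in> carrier G" and "admissible g h"
  shows "admissible (g \<otimes> h) h"
proof -
  consider "\<phi> h > 0" | "\<phi> h < 0" | "\<phi> h = 0"
    by linarith
  then show ?thesis
  proof cases
    case 1
    then show ?thesis
      using assms admissible_mult_pos by blast
  next
    case 2
    \<comment> \<open>The positive case is applied to \<open>inv h\<close> with first entry
      \<open>g \<otimes> h\<close>, so it leads from \<open>g \<otimes> h\<close> back to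
      \<open>g\<close>.\<close>
    then have "admissible (g \<otimes> h \<otimes> inv h) (inv h) \<longleftrightarrow> admissible (g \<otimes> h) (inv h)"
      using g h by (intro admissible_mult_pos) simp_all
    then show ?thesis
      using assms by (simp add: m_assoc admissible_inv_right)
  next
    case 3
    \<comment> \<open>Unless \<phi> vanishes on both entries, the algorithm stops at once with
      \<open>h\<close> in the role of \<open>x\<close>. \<open>twisted_flip\<close> disposes of the
      sign of the other entry, which \<open>twisted_mult\<close> then multiplies by
      \<open>h\<close>.\<close>
    then show ?thesis
      using assms
      by (cases "\<phi> g = 0") (auto simp: admissible_def twisted_flip flip_def [of h] intro: twisted_mult)
  qed
qed

lemma elementary_equiv_admissible:
  assumes "elementary_equiv G [g, h] hs" "g \<in> carrier G" "h \<in> carrier G" "admissible g h"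
  shows "\<exists>g' \<in> carrier G. \<exists>h' \<in> carrier G. hs = [g', h'] \<and> admissible g' h'"
  using assms(1)
proof cases
  case (permute \<sigma>)
  have eq: "hs = [[g, h] ! \<sigma> 0, [g, h] ! \<sigma> 1]"
    using permute(1) by (simp add: permute_list_def)
  have "inj_on \<sigma> {..<2}" "\<sigma> ` {..<2} = {..<2}"
    using permute(2) by (simp_all add: permutes_inj_on permutes_image eval_nat_numeral)
  then have "\<sigma> 0 < 2" "\<sigma> 1 < 2" "\<sigma> 0 \<noteq> \<sigma> 1"
    using inj_onD [of \<sigma> "{..<2}" 0 1] by auto
  then have "\<sigma> 0 = 0 \<and> \<sigma> 1 = 1 \<or> \<sigma> 0 = 1 \<and> \<sigma> 1 = 0"
    by linarith
  then show ?thesis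
    using assms eq admissible_swap by auto
next
  case (invert i)
  then have "i = 0 \<or> i = 1"
    by auto
  then show ?thesis
    using invert assms admissible_inv_left admissible_inv_right by auto
next
  case (multiply i j \<epsilon>)
  have inv_mult: "admissible (a \<otimes> inv b) b"
    if "a \<in> carrier G" "b \<in> carrier G" "admissible a b" for a b
    using that admissible_mult [of a "inv b"] by (simp add: admissible_inv_right)
  have sym: "admissible h g"
    using assms admissible_swap by blast
  have pow: "a [^] (-1 :: int) = inv a" "a [^] (1 :: int) = a" if "a \<in> carrier G" for a
    using that by (simp_all add: int_pow_neg)
  have "i = 0 \<and> j = 1 \<or> i = 1 \<and> j = 0"
    using multiply by auto
  then show ?thesis
    using multiply assms sym
      admissible_mult [of g h] admissible_mult [of h g] inv_mult [of g h] inv_mult [of h g]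
      admissible_swap [of "h \<otimes> g" g] admissible_swap [of "h \<otimes> inv g" g]
    by (auto simp: pow)
qed

text \<open>When only the first entry lies in the kernel of \<phi>, the pair is already reduced and
  \<open>admissible\<close> is the relation itself. So reflexivity starts the induction, and at the
  end of the chain the invariant is the claim; \<open>\<phi> y' \<noteq> 0\<close> keeps it away
  from the junk value there.\<close>

lemma nielsen_equiv_imp_twisted:
  assumes "nielsen_equiv G [x, y] [x', y']"
    and "\<phi> x = 0" "\<phi> y \<noteq> 0" "\<phi> x' = 0" "\<phi> y' \<noteq> 0"
  shows "twisted x y x' y'"
proof -
  have "\<exists>g \<in> carrier G. \<exists>h \<in> carrier G. hs = [g, h] \<and> admissible g h"
    if "(elementary_equiv G)\<^sup>*\<^sup>* [x, y] hs" for hs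
    using that
  proof induction
    case base
    then show ?case
      using assms by (simp add: admissible_def twisted_flip flip_def [of x] twisted_refl)
  next
    case (step gs hs)
    then show ?case
      using elementary_equiv_admissible by blast
  qed
  with assms(1) have "admissible x' y'" "x' \<in> carrier G" "y' \<in> carrier G"
    unfolding nielsen_equiv_def by fastforce+
  then show ?thesis
    using assms by (simp add: admissible_def twisted_flip flip_def [of x'])
qed

end

end

section \<open>Nielsen moves realising the relation of the theorem\<close>

lemma nielsen_equiv_trans [trans]:
  "nielsen_equiv G gs hs \<Longrightarrow> nielsen_equiv G hs ks \<Longrightarrow> nielsen_equiv G gs ks"
  unfolding nielsen_equiv_def by (rule rtranclp_trans)

lemma nielsen_equiv_moves:
  assumes "g \<in> carrier G" "h \<in> carrier G"
  shows nielsen_equiv_swap: "nielsen_equiv G [g, h] [h, g]"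
    and nielsen_equiv_inv_left: "nielsen_equiv G [g, h] [inv g, h]"
    and nielsen_equiv_inv_right: "nielsen_equiv G [g, h] [g, inv h]"
    and nielsen_equiv_mult: "nielsen_equiv G [g, h] [g, h \<otimes> g]"
    and nielsen_equiv_mult_inv: "nielsen_equiv G [g, h] [g, h \<otimes> inv g]"
proof -
  have "transpose 0 1 permutes {..<length [g, h]}"
    by (rule permutes_swap_id) simp_all
  from elementary_equiv.permute [OF this, of G]
  show "nielsen_equiv G [g, h] [h, g]"
    by (simp add: nielsen_equiv_def permute_list_def r_into_rtranclp)
  show "nielsen_equiv G [g, h] [inv g, h]" "nielsen_equiv G [g, h] [g, inv h]"
    using elementary_equiv.invert [of 0 "[g, h]" G] elementary_equiv.invert [of 1 "[g, h]" G]
    by (simp_all add: nielsen_equiv_def r_into_rtranclp)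
  show "nielsen_equiv G [g, h] [g, h \<otimes> g]" "nielsen_equiv G [g, h] [g, h \<otimes> inv g]"
    using elementary_equiv.multiply [of 1 "[g, h]" 0 1 G] elementary_equiv.multiply [of 1 "[g, h]" 0 "-1" G]
      assms
    by (simp_all add: nielsen_equiv_def r_into_rtranclp int_pow_neg)
qed

lemma int_pow_minus_1:
  assumes "g \<in> carrier G"
  shows "g [^] (k - 1 :: int) = g [^] k \<otimes> inv g"
  using assms int_pow_mult [of g k "-1"] by (simp add: int_pow_neg)

lemma int_pow_conj:
  assumes "u \<in> carrier G" "g \<in> carrier G"
  shows "(u \<otimes> g \<otimes> inv u) [^] (k :: int) = u \<otimes> g [^] k \<otimes> inv u"
proof (induction k rule: int_induct [of _ 0])
  case (step1 k)
  then show ?case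
    using assms by (simp add: int_pow_mult word_simps)
next
  case (step2 k)
  then show ?case
    using assms by (simp add: int_pow_minus_1 word_simps)
qed (use assms in simp)

lemma nielsen_equiv_mult_int_pow:
  assumes "g \<in> carrier G" "h \<in> carrier G"
  shows "nielsen_equiv G [g, h] [g, h \<otimes> g [^] (k :: int)]"
proof (induction k rule: int_induct [of _ 0])
  case base
  then show ?case
    using assms by (simp add: nielsen_equiv_def)
next
  case (step1 k)
  have "nielsen_equiv G [g, h \<otimes> g [^] k] [g, h \<otimes> g [^] k \<otimes> g]"
    using assms by (intro nielsen_equiv_mult) simp_all
  then show ?case
    using step1 assms nielsen_equiv_trans by (simp add: int_pow_mult m_assoc)
next
  case (step2 k)
  have "nielsen_equiv G [g, h \<otimes> g [^] k] [g, h \<otimes> g [^] k \<otimes> inv g]"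
    using assms by (intro nielsen_equiv_mult_inv) simp_all
  then show ?case
    using step2 assms nielsen_equiv_trans by (simp add: int_pow_minus_1 m_assoc)
qed

text \<open>Elementary moves multiply on the right only. A left multiplication is obtained as a
  right multiplication by the inverse between two inversions of the second entry.\<close>

lemma nielsen_equiv_conj_left:
  assumes "g \<in> carrier G" "h \<in> carrier G"
  shows "nielsen_equiv G [g, h] [g, g \<otimes> h \<otimes> inv g]"
    and "nielsen_equiv G [g, h] [g, inv g \<otimes> h \<otimes> g]"
proof -
  have "nielsen_equiv G [g, h] [g, h \<otimes> inv g]"
    by (rule nielsen_equiv_mult_inv) (fact assms)+
  also have "nielsen_equiv G \<dots> [g, inv (h \<otimes> inv g)]"
    using assms by (intro nielsen_equiv_inv_right) simp_all
  also have "nielsen_equiv G \<dots> [g, inv (h \<otimes> inv g) \<otimes> inv g]"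
    using assms by (intro nielsen_equiv_mult_inv) simp_all
  also have "nielsen_equiv G \<dots> [g, inv (inv (h \<otimes> inv g) \<otimes> inv g)]"
    using assms by (intro nielsen_equiv_inv_right) simp_all
  finally show "nielsen_equiv G [g, h] [g, g \<otimes> h \<otimes> inv g]"
    using assms by (simp add: word_simps)
  have "nielsen_equiv G [g, h] [g, h \<otimes> g]"
    by (rule nielsen_equiv_mult) (fact assms)+
  also have "nielsen_equiv G \<dots> [g, inv (h \<otimes> g)]"
    using assms by (intro nielsen_equiv_inv_right) simp_all
  also have "nielsen_equiv G \<dots> [g, inv (h \<otimes> g) \<otimes> g]"
    using assms by (intro nielsen_equiv_mult) simp_all
  also have "nielsen_equiv G \<dots> [g, inv (inv (h \<otimes> g) \<otimes> g)]"
    using assms by (intro nielsen_equiv_inv_right) simp_all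
  finally show "nielsen_equiv G [g, h] [g, inv g \<otimes> h \<otimes> g]"
    using assms by (simp add: word_simps)
qed

lemma nielsen_equiv_conj_right:
  assumes "g \<in> carrier G" "h \<in> carrier G"
  shows "nielsen_equiv G [g, h] [h \<otimes> g \<otimes> inv h, h]"
    and "nielsen_equiv G [g, h] [inv h \<otimes> g \<otimes> h, h]"
proof -
  have swap: "nielsen_equiv G [g, h] [k, h]" if "nielsen_equiv G [h, g] [h, k]" "k \<in> carrier G" for k
    using that assms nielsen_equiv_swap [of g h] nielsen_equiv_swap [of h k] nielsen_equiv_trans
    by meson
  show "nielsen_equiv G [g, h] [h \<otimes> g \<otimes> inv h, h]" "nielsen_equiv G [g, h] [inv h \<otimes> g \<otimes> h, h]"
    using assms by (auto intro!: swap nielsen_equiv_conj_left)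
qed

text \<open>Conjugating by \<open>u a\<close> instead of \<open>u\<close> amounts to conjugating the pair by its own entry
  \<open>u a u\<inverse>\<close>, which is a Nielsen move.\<close>

lemma nielsen_equiv_conj_generate:
  assumes a: "a \<in> carrier G" and b: "b \<in> carrier G"
    and "g \<in> generate G {a, b}" and "u \<in> carrier G"
  shows "nielsen_equiv G [u \<otimes> a \<otimes> inv u, u \<otimes> b \<otimes> inv u]
    [u \<otimes> g \<otimes> a \<otimes> inv (u \<otimes> g), u \<otimes> g \<otimes> b \<otimes> inv (u \<otimes> g)]"
  using assms(3,4)
\<comment> \<open>\<open>u\<close> is kept general because, for a product, the hypothesis on the
  second factor is applied at \<open>u \<otimes> g\<close>.\<close>
proof (induction arbitrary: u)
  case one
  then show ?case
    using a b by (simp add: nielsen_equiv_def)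
next
  case (incl h)
  then consider "h = a" | "h = b"
    by blast
  then show ?case
  proof cases
    case 1
    then show ?thesis
      using nielsen_equiv_conj_left(1) [of "u \<otimes> a \<otimes> inv u" "u \<otimes> b \<otimes> inv u"] incl a b
      by (simp add: word_simps)
  next
    case 2
    then show ?thesis
      using nielsen_equiv_conj_right(1) [of "u \<otimes> a \<otimes> inv u" "u \<otimes> b \<otimes> inv u"] incl a b
      by (simp add: word_simps)
  qed
next
  case (inv h)
  then consider "h = a" | "h = b"
    by blast
  then show ?case
  proof cases
    case 1
    then show ?thesis
      using nielsen_equiv_conj_left(2) [of "u \<otimes> a \<otimes> inv u" "u \<otimes> b \<otimes> inv u"] inv a b
      by (simp add: word_simps)
  next
    case 2
    then show ?thesis
      using nielsen_equiv_conj_right(2) [of "u \<otimes> a \<otimes> inv u" "u \<otimes> b \<otimes> inv u"] inv a b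
      by (simp add: word_simps)
  qed
next
  case (eng g h)
  have "g \<in> carrier G" "h \<in> carrier G"
    using eng generate_incl [of "{a, b}"] a b by auto
  then have assoc: "u \<otimes> g \<otimes> h = u \<otimes> (g \<otimes> h)" and "u \<otimes> g \<in> carrier G"
    using eng.prems by (simp_all add: m_assoc)
  then show ?case
    using nielsen_equiv_trans [OF eng.IH(1) [OF eng.prems] eng.IH(2) [of "u \<otimes> g"]] by simp
qed

lemma twisted_imp_nielsen_equiv:
  assumes "twisted x y x' y'" and gen: "generating_pair G x y"
  shows "nielsen_equiv G [x, y] [x', y']"
proof -
  have x: "x \<in> carrier G" and y: "y \<in> carrier G"
    using gen by (simp_all add: generating_pair_def)
  obtain u and k :: int and \<epsilon> \<eta> :: int where u: "u \<in> carrier G"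
    "\<epsilon> \<in> {-1, 1}" "\<eta> \<in> {-1, 1}" "x' = u \<otimes> x [^] \<epsilon> \<otimes> inv u"
    "y' = u \<otimes> y [^] \<eta> \<otimes> x [^] k \<otimes> inv u"
    using assms(1) unfolding twisted_def by blast
  \<comment> \<open>Generation by \<open>x\<close>, \<open>y\<close> enters here: it makes the
    conjugator \<open>u\<close> a word in them.\<close>
  have "nielsen_equiv G [x, y] [u \<otimes> x \<otimes> inv u, u \<otimes> y \<otimes> inv u]"
    using nielsen_equiv_conj_generate [of x y u \<one>] gen x y u(1) by (simp add: generating_pair_def)
  also have "nielsen_equiv G \<dots> [u \<otimes> x \<otimes> inv u, u \<otimes> y [^] \<eta> \<otimes> inv u]"
  proof -
    have "inv (u \<otimes> y \<otimes> inv u) = u \<otimes> inv y \<otimes> inv u"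
      using u y by (simp add: word_simps)
    then show ?thesis
      using nielsen_equiv_inv_right [of "u \<otimes> x \<otimes> inv u" "u \<otimes> y \<otimes> inv u"] u x y
      by (auto simp: int_pow_neg nielsen_equiv_def)
  qed
  also have "nielsen_equiv G \<dots> [u \<otimes> x \<otimes> inv u, y']"
  proof -
    have "(u \<otimes> x \<otimes> inv u) [^] k = u \<otimes> x [^] k \<otimes> inv u"
      using u x by (simp add: int_pow_conj)
    then show ?thesis
      using nielsen_equiv_mult_int_pow [of "u \<otimes> x \<otimes> inv u" "u \<otimes> y [^] \<eta> \<otimes> inv u" k] u x y
      by (simp add: word_simps)
  qed
  \<comment> \<open>The sign of \<open>x\<close> is adjusted last, because the factor
    \<open>x [^] k\<close> in \<open>y'\<close> is a power of \<open>x\<close> and not of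
    \<open>x [^] \<epsilon>\<close>.\<close>
  also have "nielsen_equiv G \<dots> [x', y']"
  proof -
    have "inv (u \<otimes> x \<otimes> inv u) = u \<otimes> inv x \<otimes> inv u"
      using u x by (simp add: word_simps)
    then show ?thesis
      using nielsen_equiv_inv_left [of "u \<otimes> x \<otimes> inv u" y'] u x y
      by (auto simp: int_pow_neg nielsen_equiv_def)
  qed
  finally show ?thesis .
qed

end

section \<open>The fundamental group of a graph of groups\<close>

sublocale graph_of_groups \<subseteq> bidirected_digraph "ugraph A" "einv A"
  by (fact bidirected)

context graph_of_groups
begin

section \<open>Composition and inversion of paths\<close>

lemma emb_closed:
  assumes "e \<in> arcs (ugraph A)" "c \<in> carrier (egrp A e)"
  shows "emb A e c \<in> carrier (vgrp A (tail (ugraph A) e))"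
  using emb_hom [OF assms(1)] assms(2) by (auto simp: hom_def)

lemma gog_path_verts:
  assumes "gog_path A u p v"
  shows "u \<in> verts (ugraph A)" "v \<in> verts (ugraph A)"
proof -
  obtain a es where p: "p = (a, es)"
    by (cases p)
  have "u \<in> verts (ugraph A) \<and> v \<in> verts (ugraph A)"
    using assms unfolding p by (induction es arbitrary: u a) auto
  then show "u \<in> verts (ugraph A)" "v \<in> verts (ugraph A)"
    by auto
qed

lemma gog_path_fst:
  assumes "gog_path A u (a, es) v"
  shows "a \<in> carrier (vgrp A u)"
  using assms by (cases es) auto

lemma gog_path_mult:
  assumes "gog_path A u p w" "gog_path A w q v"
  shows "gog_path A u (path_mult A w p q) v"
proof -
  obtain a es b fs where p: "p = (a, es)" and q: "q = (b, fs)"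
    by (cases p, cases q)
  show ?thesis
    using assms unfolding p
  proof (induction es arbitrary: u a)
    case Nil
    then interpret group "vgrp A w"
      by (auto intro: vgrp_group)
    have "a \<otimes>\<^bsub>vgrp A w\<^esub> b \<in> carrier (vgrp A w)"
      using Nil gog_path_fst [of w b fs v] by (auto simp: q)
    then show ?case
      using Nil by (cases fs) (auto simp: q)
  qed auto
qed

text \<open>Associativity holds for the paths themselves, before passing to classes, as composition
  only multiplies the vertex elements at a junction. If \<open>q\<close> has no edges, both
  junctions coincide and associativity in the vertex group applies.\<close>

lemma path_mult_assoc:
  assumes "gog_path A u p w" "gog_path A w q z" "gog_path A z r v"
  shows "path_mult A z (path_mult A w p q) r = path_mult A w p (path_mult A z q r)"
proof -
  obtain a es where p: "p = (a, es)"
    by (cases p)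
  show ?thesis
    using assms unfolding p
  proof (induction es arbitrary: u a)
    case Nil
    then interpret group "vgrp A w"
      by (auto intro: vgrp_group)
    obtain b fs c gs where q: "q = (b, fs)" and r: "r = (c, gs)"
      by (cases q, cases r)
    have abc: "a \<in> carrier (vgrp A w)" "b \<in> carrier (vgrp A w)" "fs = [] \<Longrightarrow> c \<in> carrier (vgrp A w)"
      using Nil gog_path_fst [of w b fs z] gog_path_fst [of z c gs v] by (auto simp: q r)
    show ?case
    proof (cases fs)
      case Nil': Nil
      then have "z = w"
        using Nil by (simp add: q)
      then show ?thesis
        using abc Nil' m_assoc by (simp add: q r)
    qed (auto simp: q r)
  qed auto
qed

lemma gog_path_one:
  assumes "u \<in> verts (ugraph A)"
  shows "gog_path A u (\<one>\<^bsub>vgrp A u\<^esub>, []) u"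
  using assms vgrp_group by (auto intro: monoid.one_closed group.is_monoid)

lemma path_mult_one_left:
  assumes "gog_path A u p v"
  shows "path_mult A u (\<one>\<^bsub>vgrp A u\<^esub>, []) p = p"
proof -
  interpret group "vgrp A u"
    using gog_path_verts(1) [OF assms] by (rule vgrp_group)
  obtain a es where p: "p = (a, es)"
    by (cases p)
  then have "a \<in> carrier (vgrp A u)"
    using assms gog_path_fst by blast
  then show ?thesis
    by (simp add: p)
qed

lemma gog_path_inv:
  assumes "gog_path A u p v"
  shows "gog_path A v (path_inv A u p) u"
proof -
  obtain a es where p: "p = (a, es)"
    by (cases p)
  show ?thesis
    using assms unfolding p
  proof (induction es arbitrary: u a)
    case Nil
    then interpret group "vgrp A u"
      by (auto intro: vgrp_group)
    have "inv\<^bsub>vgrp A u\<^esub> a \<in> carrier (vgrp A u)"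
      using gog_path_fst [OF Nil] by (rule inv_closed)
    then show ?case
      using Nil by auto
  next
    case (Cons f es)
    obtain e b where f: "f = (e, b)"
      by (cases f)
    have e: "e \<in> arcs (ugraph A)" "tail (ugraph A) e = u"
      using Cons.prems by (simp_all add: f)
    interpret U: group "vgrp A u"
      using e by (auto intro: vgrp_group)
    interpret W: group "vgrp A (head (ugraph A) e)"
      using e by (auto intro: vgrp_group)
    have a: "a \<in> carrier (vgrp A u)"
      using Cons.prems by (rule gog_path_fst)
    have s: "gog_path A (head (ugraph A) e) (\<one>\<^bsub>vgrp A (head (ugraph A) e)\<^esub>, [(einv A e, inv\<^bsub>vgrp A u\<^esub> a)]) u"
      using e a gog_path_verts(1) [OF Cons.prems] by simp
    have r: "gog_path A v (path_inv A (head (ugraph A) e) (b, es)) (head (ugraph A) e)"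
      using Cons by (simp add: f)
    show ?case
      using gog_path_mult [OF r s] by (simp add: f)
  qed
qed

text \<open>Supplies the left inverses that \<open>groupI\<close> asks for. The product is cancelled
  from its middle outwards.\<close>

lemma path_inv_left:
  assumes "gog_path A u p v"
  shows "path_equiv A v v (path_mult A u (path_inv A u p) p) (\<one>\<^bsub>vgrp A v\<^esub>, [])"
proof -
  obtain a es where p: "p = (a, es)"
    by (cases p)
  show ?thesis
    using assms unfolding p
  proof (induction es arbitrary: u a)
    case Nil
    then interpret group "vgrp A u"
      by (auto intro: vgrp_group)
    have "inv\<^bsub>vgrp A u\<^esub> a \<otimes>\<^bsub>vgrp A u\<^esub> a = \<one>\<^bsub>vgrp A u\<^esub>"
      using gog_path_fst [OF Nil] by (rule l_inv)
    then show ?case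
      using Nil gog_path_one by (auto intro: path_equiv.refl)
  next
    case (Cons f es)
    obtain e b where f: "f = (e, b)"
      by (cases f)
    define w where "w = head (ugraph A) e"
    have e: "e \<in> arcs (ugraph A)" "tail (ugraph A) e = u" "head (ugraph A) e = w"
      and a: "a \<in> carrier (vgrp A u)" and q: "gog_path A w (b, es) v"
      using Cons.prems by (simp_all add: f w_def)
    interpret U: group "vgrp A u"
      using e by (auto intro: vgrp_group)
    interpret W: group "vgrp A w"
      using e by (auto intro: vgrp_group)
    have b: "b \<in> carrier (vgrp A w)"
      using q by (rule gog_path_fst)
    \<comment> \<open>The path is \<open>t\<close> followed by \<open>(b, es)\<close>, and its
      inverse is \<open>r\<close> followed by \<open>s\<close>. The product of \<open>s\<close> and
      \<open>t\<close> in the middle is a backtracking along the first edge.\<close>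
    define s where "s = (\<one>\<^bsub>vgrp A w\<^esub>, [(einv A e, inv\<^bsub>vgrp A u\<^esub> a)])"
    define t where "t = (a, [(e, \<one>\<^bsub>vgrp A w\<^esub>)])"
    define r where "r = path_inv A w (b, es)"
    have verts: "u \<in> verts (ugraph A)" "w \<in> verts (ugraph A)"
      using e by auto
    have s: "gog_path A w s u" and t: "gog_path A u t w"
      using e a verts by (auto simp: s_def t_def)
    have r: "gog_path A v r w"
      unfolding r_def using q by (rule gog_path_inv)
    \<comment> \<open>\<open>cancel\<close> is applied to the arc \<open>einv A e\<close>, with
      which the backtracking begins; the inverse of that arc is \<open>e\<close> again.\<close>
    have "path_equiv A w w (\<one>\<^bsub>vgrp A w\<^esub>, [(einv A e, \<one>\<^bsub>vgrp A u\<^esub>), (einv A (einv A e), \<one>\<^bsub>vgrp A w\<^esub>)])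
        (\<one>\<^bsub>vgrp A w\<^esub> \<otimes>\<^bsub>vgrp A w\<^esub> \<one>\<^bsub>vgrp A w\<^esub>, [])"
      using e by (intro path_equiv.cancel) auto
    then have st: "path_equiv A w w (path_mult A u s t) (\<one>\<^bsub>vgrp A w\<^esub>, [])"
      using a by (simp add: s_def t_def)
    have "path_mult A u (path_inv A u (a, f # es)) (a, f # es) =
        path_mult A u (path_mult A w r s) (path_mult A w t (b, es))"
      using b by (cases es) (simp_all add: f e r_def s_def t_def)
    also have "\<dots> = path_mult A w r (path_mult A u s (path_mult A w t (b, es)))"
      using path_mult_assoc [OF r s gog_path_mult [OF t q]] .
    also have "path_mult A u s (path_mult A w t (b, es)) = path_mult A w (path_mult A u s t) (b, es)"
      using path_mult_assoc [OF s t q] by simp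
    finally have eq: "path_mult A u (path_inv A u (a, f # es)) (a, f # es) =
        path_mult A w r (path_mult A w (path_mult A u s t) (b, es))" .
    have "path_equiv A v v (path_mult A w r (path_mult A w (path_mult A u s t) (b, es)))
        (path_mult A w r (path_mult A w (\<one>\<^bsub>vgrp A w\<^esub>, []) (b, es)))"
      by (intro path_equiv.cong path_equiv.refl) (rule r st q)+
    then have "path_equiv A v v (path_mult A u (path_inv A u (a, f # es)) (a, f # es))
        (path_mult A w r (b, es))"
      using path_mult_one_left [OF q] eq by simp
    then show ?case
      using Cons.IH [OF q] r_def path_equiv.trans by metis
  qed
qed

section \<open>The group of classes of closed paths\<close>

lemma path_class_eq:
  assumes "path_equiv A u v p q"
  shows "path_class A u v p = path_class A u v q"
  using path_equiv.trans [OF assms] path_equiv.trans [OF path_equiv.sym [OF assms]]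
  by (auto simp: path_class_def)

text \<open>The product of two classes is a union over all representatives. By
  \<open>path_equiv.cong\<close> every set in this union is the same class.\<close>

lemma fundamental_group_mult:
  assumes "gog_path A v\<^sub>0 p v\<^sub>0" "gog_path A v\<^sub>0 q v\<^sub>0"
  shows "path_class A v\<^sub>0 v\<^sub>0 p \<otimes>\<^bsub>fundamental_group A v\<^sub>0\<^esub> path_class A v\<^sub>0 v\<^sub>0 q =
    path_class A v\<^sub>0 v\<^sub>0 (path_mult A v\<^sub>0 p q)"
proof -
  let ?P = "path_class A v\<^sub>0 v\<^sub>0 p" and ?Q = "path_class A v\<^sub>0 v\<^sub>0 q"
  have "path_class A v\<^sub>0 v\<^sub>0 (path_mult A v\<^sub>0 p' q') = path_class A v\<^sub>0 v\<^sub>0 (path_mult A v\<^sub>0 p q)"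
    if "p' \<in> ?P" "q' \<in> ?Q" for p' q'
    using that path_class_eq [OF path_equiv.cong] by (simp add: path_class_def)
  then have "(\<Union>p' \<in> ?P. \<Union>q' \<in> ?Q. path_class A v\<^sub>0 v\<^sub>0 (path_mult A v\<^sub>0 p' q')) =
      (\<Union>p' \<in> ?P. \<Union>q' \<in> ?Q. path_class A v\<^sub>0 v\<^sub>0 (path_mult A v\<^sub>0 p q))"
    by (intro SUP_cong) simp_all
  \<comment> \<open>A union of a constant family has that constant value only if the index set is
    nonempty.\<close>
  moreover have "p \<in> ?P" "q \<in> ?Q"
    using assms by (simp_all add: path_class_def path_equiv.refl)
  then have "?P \<noteq> {}" "?Q \<noteq> {}"
    by blast+
  ultimately show ?thesis
    by (simp add: fundamental_group_def)
qed

lemma carrier_fundamental_group: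
  "carrier (fundamental_group A v\<^sub>0) = {path_class A v\<^sub>0 v\<^sub>0 p |p. gog_path A v\<^sub>0 p v\<^sub>0}"
  by (simp add: fundamental_group_def)

lemma one_fundamental_group:
  "\<one>\<^bsub>fundamental_group A v\<^sub>0\<^esub> = path_class A v\<^sub>0 v\<^sub>0 (\<one>\<^bsub>vgrp A v\<^sub>0\<^esub>, [])"
  by (simp add: fundamental_group_def)

lemma group_fundamental_group:
  assumes v\<^sub>0: "v\<^sub>0 \<in> verts (ugraph A)"
  shows "group (fundamental_group A v\<^sub>0)"
proof (rule groupI)
  fix X Y
  assume "X \<in> carrier (fundamental_group A v\<^sub>0)" "Y \<in> carrier (fundamental_group A v\<^sub>0)"
  then obtain p q where p: "gog_path A v\<^sub>0 p v\<^sub>0" "X = path_class A v\<^sub>0 v\<^sub>0 p"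
    and q: "gog_path A v\<^sub>0 q v\<^sub>0" "Y = path_class A v\<^sub>0 v\<^sub>0 q"
    unfolding carrier_fundamental_group by blast
  have "gog_path A v\<^sub>0 (path_mult A v\<^sub>0 p q) v\<^sub>0"
    using p(1) q(1) by (rule gog_path_mult)
  then show "X \<otimes>\<^bsub>fundamental_group A v\<^sub>0\<^esub> Y \<in> carrier (fundamental_group A v\<^sub>0)"
    unfolding p(2) q(2) fundamental_group_mult [OF p(1) q(1)] carrier_fundamental_group by blast
  fix Z
  assume "Z \<in> carrier (fundamental_group A v\<^sub>0)"
  then obtain r where r: "gog_path A v\<^sub>0 r v\<^sub>0" "Z = path_class A v\<^sub>0 v\<^sub>0 r"
    unfolding carrier_fundamental_group by blast
  show "X \<otimes>\<^bsub>fundamental_group A v\<^sub>0\<^esub> Y \<otimes>\<^bsub>fundamental_group A v\<^sub>0\<^esub> Z =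
    X \<otimes>\<^bsub>fundamental_group A v\<^sub>0\<^esub> (Y \<otimes>\<^bsub>fundamental_group A v\<^sub>0\<^esub> Z)"
    unfolding p(2) q(2) r(2) fundamental_group_mult [OF p(1) q(1)] fundamental_group_mult [OF q(1) r(1)]
      fundamental_group_mult [OF gog_path_mult [OF p(1) q(1)] r(1)]
      fundamental_group_mult [OF p(1) gog_path_mult [OF q(1) r(1)]]
      path_mult_assoc [OF p(1) q(1) r(1)] ..
next
  show "\<one>\<^bsub>fundamental_group A v\<^sub>0\<^esub> \<in> carrier (fundamental_group A v\<^sub>0)"
    unfolding carrier_fundamental_group one_fundamental_group using gog_path_one [OF v\<^sub>0] by blast
next
  fix X
  assume "X \<in> carrier (fundamental_group A v\<^sub>0)"
  then obtain p where p: "gog_path A v\<^sub>0 p v\<^sub>0" "X = path_class A v\<^sub>0 v\<^sub>0 p"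
    by (auto simp: carrier_fundamental_group)
  show "\<one>\<^bsub>fundamental_group A v\<^sub>0\<^esub> \<otimes>\<^bsub>fundamental_group A v\<^sub>0\<^esub> X = X"
    using p gog_path_one [OF v\<^sub>0]
    by (simp add: one_fundamental_group fundamental_group_mult path_mult_one_left)
  have "path_class A v\<^sub>0 v\<^sub>0 (path_inv A v\<^sub>0 p) \<otimes>\<^bsub>fundamental_group A v\<^sub>0\<^esub> X = \<one>\<^bsub>fundamental_group A v\<^sub>0\<^esub>"
    using p path_class_eq [OF path_inv_left [OF p(1)]]
    by (simp add: one_fundamental_group fundamental_group_mult gog_path_inv)
  then show "\<exists>Y \<in> carrier (fundamental_group A v\<^sub>0).
      Y \<otimes>\<^bsub>fundamental_group A v\<^sub>0\<^esub> X = \<one>\<^bsub>fundamental_group A v\<^sub>0\<^esub>"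
    unfolding carrier_fundamental_group using gog_path_inv [OF p(1)] by blast
qed

text \<open>Connectedness refers to the symmetric closure of adjacency; an arc met in the wrong
  direction is replaced by its inverse. The lemma joins the base point to a circuit.\<close>

lemma ex_gog_path:
  assumes "u \<in> verts (ugraph A)" "v \<in> verts (ugraph A)"
  shows "\<exists>p. gog_path A u p v"
proof -
  have step: "\<exists>p. gog_path A a p b" if ab: "(a, b) \<in> (arcs_ends (ugraph A))\<^sup>s" for a b
  proof -
    obtain e where e: "e \<in> arcs (ugraph A)" "tail (ugraph A) e = a" "head (ugraph A) e = b"
    proof -
      from ab obtain f where f: "f \<in> arcs (ugraph A)"
        "tail (ugraph A) f = a \<and> head (ugraph A) f = b \<or> tail (ugraph A) f = b \<and> head (ugraph A) f = a"
        by (auto simp: symcl_def arcs_ends_def arc_to_ends_def)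
      then show ?thesis
        using that [of f] that [of "einv A f"] by auto
    qed
    then have "gog_path A a (\<one>\<^bsub>vgrp A a\<^esub>, [(e, \<one>\<^bsub>vgrp A b\<^esub>)]) b"
      using gog_path_one [of a] gog_path_one [of b] by auto
    then show ?thesis
      by blast
  qed
  have "(u, v) \<in> rtrancl_on (verts (ugraph A)) ((arcs_ends (ugraph A))\<^sup>s)"
    using connected assms by (simp add: connected_conv)
  then show ?thesis
  proof induction
    case base
    then show ?case
      using gog_path_one by blast
  next
    case (step b c)
    then show ?case
      using \<open>\<And>b a. (a, b) \<in> (arcs_ends (ugraph A))\<^sup>s \<Longrightarrow> \<exists>p. gog_path A a p b\<close> gog_path_mult by blast
  qed
qed

end

section \<open>Homomorphisms to the integers from edge weights\<close>

section \<open>Weights on edges\<close>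

definition path_weight :: "('e \<Rightarrow> int) \<Rightarrow> ('e, 'a) gpath \<Rightarrow> int" where
  "path_weight w p = (\<Sum>(e, a)\<leftarrow>snd p. w e)"

text \<open>The chosen representative is immaterial as soon as inverse arcs have opposite
  weights.\<close>

definition class_weight :: "('e \<Rightarrow> int) \<Rightarrow> ('e, 'a) gpath set \<Rightarrow> int" where
  "class_weight w X = path_weight w (SOME p. p \<in> X)"

lemma path_weight_simps [simp]:
  "path_weight w (a, []) = 0"
  "path_weight w (a, (e, b) # es) = w e + path_weight w (b, es)"
  by (simp_all add: path_weight_def)

lemma path_weight_mult: "path_weight w (path_mult A z p q) = path_weight w p + path_weight w q"
  by (induction A z p q rule: path_mult.induct) (auto simp: path_weight_def)

context graph_of_groups
begin

context
  fixes w :: "'e \<Rightarrow> int"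
  assumes w_einv: "w (einv A e) = - w e"
begin

lemma path_weight_inv: "path_weight w (path_inv A u p) = - path_weight w p"
proof -
  obtain a es where p: "p = (a, es)"
    by (cases p)
  show ?thesis
    unfolding p by (induction es arbitrary: u a) (auto simp: path_weight_mult w_einv)
qed

text \<open>\<open>slide\<close> changes vertex elements only, and \<open>cancel\<close> removes two
  arcs of opposite weights.\<close>

lemma path_weight_equiv:
  assumes "path_equiv A u v p q"
  shows "path_weight w p = path_weight w q"
  using assms
proof induction
  case (cong u w p p' v q q')
  then show ?case
    by (simp add: path_weight_mult)
qed (auto simp: w_einv)

lemma class_weight_path_class:
  assumes "gog_path A u p v"
  shows "class_weight w (path_class A u v p) = path_weight w p"
proof -
  have "p \<in> path_class A u v p"
    using assms by (simp add: path_class_def path_equiv.refl)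
  then have "(SOME q. q \<in> path_class A u v p) \<in> path_class A u v p"
    by (rule someI)
  then show ?thesis
    unfolding class_weight_def using path_weight_equiv [of u v p] by (simp add: path_class_def)
qed

lemma class_weight_mult:
  assumes "X \<in> carrier (fundamental_group A v\<^sub>0)" "Y \<in> carrier (fundamental_group A v\<^sub>0)"
  shows "class_weight w (X \<otimes>\<^bsub>fundamental_group A v\<^sub>0\<^esub> Y) = class_weight w X + class_weight w Y"
  using assms
  by (auto simp: carrier_fundamental_group fundamental_group_mult class_weight_path_class
      gog_path_mult path_weight_mult)

end

end

text \<open>The arcs of a cycle have distinct heads, so \<open>e\<close> does not recur. Its inverse
  ends where the arc before \<open>e\<close> ends, so it could only be that arc, which the absence
  of backtracking excludes.\<close>

lemma (in bidirected_digraph) circuit_last_arc: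
  assumes "circuit G arev p"
  obtains u q e where "awalk u (q @ [e]) u" "p = q @ [e]" "e \<notin> set q" "arev e \<notin> set q"
proof -
  from assms obtain u where u: "awalk u p u" "distinct (tl (awalk_verts u p))" "p \<noteq> []"
    and succ: "successively (\<lambda>e f. f \<noteq> arev e) p"
    by (auto simp: circuit_def cycle_def)
  \<comment> \<open>The last arc is taken because the list contains its predecessor;
    \<open>successively\<close> does not compare the last arc with the first.\<close>
  define q e where "q = butlast p" and "e = last p"
  have p: "p = q @ [e]"
    using u(3) by (simp add: q_def e_def)
  have "tl (awalk_verts u p) = map (head G) p"
    using u(1,3) awalk_verts_conv' [of u p u] by (simp add: awalk_def)
  then have heads: "distinct (map (head G) (q @ [e]))"
    using u(2) p by simp
  have e: "e \<in> arcs G"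
    using u(1) by (auto simp: p awalk_def)
  have "arev e \<notin> set q"
  proof
    assume rev: "arev e \<in> set q"
    then obtain q' f where q: "q = q' @ [f]"
      by (metis empty_iff empty_set rev_exhaust)
    have "head G f = tail G e"
      using u(1) by (auto simp: p q awalk_def)
    then have "head G (arev e) = head G f"
      using e by simp
    then have "arev e = f"
      using rev heads q by (auto simp: rev_image_eqI)
    moreover have "e \<noteq> arev f"
      using succ by (simp add: p q successively_append_iff)
    ultimately show False
      by auto
  qed
  moreover have "e \<notin> set q"
    using heads by auto
  ultimately show ?thesis
    using that u(1) p by blast
qed


context graph_of_groups
begin

text \<open>In \<open>p\<close>, \<open>a\<close>, inverse of \<open>p\<close> the weights of the
  outer parts cancel, and a homomorphism to an abelian group is constant on conjugacy
  classes.\<close>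

lemma class_weight_elliptic:
  assumes w_einv: "\<And>e. w (einv A e) = - w e" and v\<^sub>0: "v\<^sub>0 \<in> verts (ugraph A)"
    and "elliptic A v\<^sub>0 X"
  shows "class_weight w X = 0"
proof -
  interpret G: group "fundamental_group A v\<^sub>0"
    using v\<^sub>0 by (rule group_fundamental_group)
  let ?G = "fundamental_group A v\<^sub>0"
  obtain v p a g where p: "gog_path A v\<^sub>0 p v" and a: "a \<in> carrier (vgrp A v)"
    and g: "g \<in> carrier ?G"
    and X: "X = g \<otimes>\<^bsub>?G\<^esub>
      path_class A v\<^sub>0 v\<^sub>0 (path_mult A v (path_mult A v p (a, [])) (path_inv A v\<^sub>0 p)) \<otimes>\<^bsub>?G\<^esub> inv\<^bsub>?G\<^esub> g"
    using assms(3) unfolding elliptic_def vertex_subgroup_def by blast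
  define q where "q = path_mult A v (path_mult A v p (a, [])) (path_inv A v\<^sub>0 p)"
  have "gog_path A v (a, []) v"
    using a gog_path_verts [OF p] by simp
  then have q: "gog_path A v\<^sub>0 q v\<^sub>0"
    unfolding q_def using p by (intro gog_path_mult gog_path_inv)
  have "path_weight w q = 0"
    by (simp add: q_def path_weight_mult path_weight_inv w_einv)
  then have "class_weight w (path_class A v\<^sub>0 v\<^sub>0 q) = 0"
    using class_weight_path_class [of w, OF w_einv q] by simp
  moreover have "path_class A v\<^sub>0 v\<^sub>0 q \<in> carrier ?G"
    unfolding carrier_fundamental_group using q by blast
  ultimately show ?thesis
    using g class_weight_mult [of w, OF w_einv, where v\<^sub>0 = v\<^sub>0]
      G.int_hom_inv [of "class_weight w" g] by (simp add: X flip: q_def)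
qed

lemma ex_class_weight:
  assumes "\<not> serre_tree (ugraph A) (einv A)" and v\<^sub>0: "v\<^sub>0 \<in> verts (ugraph A)"
  obtains w X where "\<And>e. w (einv A e) = - w e"
    "X \<in> carrier (fundamental_group A v\<^sub>0)" "class_weight w X \<noteq> 0"
proof -
  obtain c where "circuit (ugraph A) (einv A) c"
    using assms connected by (auto simp: serre_tree_def)
  then obtain u q e where walk: "awalk u (q @ [e]) u" and e: "e \<notin> set q" "einv A e \<notin> set q"
    by (rule circuit_last_arc)
  \<comment> \<open>\<open>w\<close> counts signed passages through the last arc of the circuit. As
    neither this arc nor its inverse occurs elsewhere in it, the circuit has weight 1.\<close>
  define w :: "'e \<Rightarrow> int" where "w f = (if f = e then 1 else if f = einv A e then -1 else 0)" for f
  have "e \<in> arcs (ugraph A)"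
    using walk by (simp add: awalk_def)
  \<comment> \<open>The values 1 and -1 do not collide, because the involution fixes no arc.\<close>
  then have "einv A e \<noteq> e"
    by (rule arev_neq)
  then have w_einv: "w (einv A f) = - w f" for f
    using arev_eq_iff [of f e] by (auto simp: w_def)
  have path: "gog_path A a (\<one>\<^bsub>vgrp A a\<^esub>, map (\<lambda>f. (f, \<one>\<^bsub>vgrp A (head (ugraph A) f)\<^esub>)) fs) b"
    if "awalk a fs b" for a fs b
    using that
  proof (induction fs arbitrary: a)
    case Nil
    then show ?case
      using gog_path_one [of b] by (auto simp: awalk_Nil_iff)
  next
    case (Cons f fs)
    then show ?case
      using gog_path_one [of a] by (auto simp: awalk_Cons_iff)
  qed
  define r where "r = (\<one>\<^bsub>vgrp A u\<^esub>, map (\<lambda>f. (f, \<one>\<^bsub>vgrp A (head (ugraph A) f)\<^esub>)) (q @ [e]))"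
  have r: "gog_path A u r u"
    unfolding r_def using walk by (rule path)
  have "map w q = map (\<lambda>f. 0) q"
    using e by (auto simp: w_def)
  then have "sum_list (map w q) = sum_list (map (\<lambda>f. 0) q)"
    by (rule arg_cong)
  moreover have "w e = 1"
    by (simp add: w_def)
  ultimately have "path_weight w r = 1"
    by (simp add: r_def path_weight_def o_def)
  obtain p where p: "gog_path A v\<^sub>0 p u"
    using ex_gog_path [OF v\<^sub>0 awalk_last_in_verts [OF walk]] by blast
  \<comment> \<open>Conjugation by a path from \<open>v\<^sub>0\<close> to the circuit moves it to
    the base point and preserves its weight.\<close>
  define s where "s = path_mult A u (path_mult A u p r) (path_inv A v\<^sub>0 p)"
  have s: "gog_path A v\<^sub>0 s v\<^sub>0"
    unfolding s_def using p r by (intro gog_path_mult gog_path_inv)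
  have "path_weight w s = 1"
    using \<open>path_weight w r = 1\<close> by (simp add: s_def path_weight_mult path_weight_inv w_einv)
  then have "class_weight w (path_class A v\<^sub>0 v\<^sub>0 s) = 1"
    using class_weight_path_class [of w, OF w_einv s] by simp
  moreover have "path_class A v\<^sub>0 v\<^sub>0 s \<in> carrier (fundamental_group A v\<^sub>0)"
    unfolding carrier_fundamental_group using s by blast
  ultimately show ?thesis
    using that [of w, OF w_einv] by force
qed

end

section \<open>Both directions of the equivalence, with \<open>class_weight w\<close> as
  \<phi>\<close>

theorem theorem2p1:
  fixes A :: "('v, 'e, 'a, 'c) gog" and v\<^sub>0 :: 'v
    and G :: "('e, 'a) gpath set monoid" (structure)
    and x y x' y' :: "('e, 'a) gpath set"
  assumes "graph_of_groups A"
    and "\<not> serre_tree (ugraph A) (einv A)"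
    and "v\<^sub>0 \<in> verts (ugraph A)"
    and "G = fundamental_group A v\<^sub>0"
    and "generating_pair G x y"
    and "generating_pair G x' y'"
    and "elliptic A v\<^sub>0 x"
    and "elliptic A v\<^sub>0 x'"
  shows "nielsen_equiv G [x, y] [x', y'] \<longleftrightarrow>
    (\<exists>g \<in> carrier G. \<exists>k :: int. \<exists>\<epsilon> \<in> {-1, 1 :: int}. \<exists>\<eta> \<in> {-1, 1 :: int}.
      x' = g \<otimes> x [^] \<epsilon> \<otimes> inv g \<and> y' = g \<otimes> y [^] \<eta> \<otimes> x [^] k \<otimes> inv g)"
proof -
  interpret graph_of_groups A
    by fact
  interpret group G
    unfolding assms(4) using assms(3) by (rule group_fundamental_group)
  obtain w X where w_einv: "\<And>e. w (einv A e) = - w e"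
    and X: "X \<in> carrier G" "class_weight w X \<noteq> 0"
    using ex_class_weight [OF assms(2,3)] unfolding assms(4) by blast
  have hom: "class_weight w (a \<otimes> b) = class_weight w a + class_weight w b"
    if "a \<in> carrier G" "b \<in> carrier G" for a b
    using class_weight_mult [of w, OF w_einv] that unfolding assms(4) .
  have zero: "class_weight w x = 0" "class_weight w x' = 0"
    using class_weight_elliptic [of w, OF w_einv assms(3)] assms(7,8) by blast+
  \<comment> \<open>\<open>X\<close> shows that the weight homomorphism is not zero, so it cannot
    vanish on both entries of a generating pair.\<close>
  have nonzero: "class_weight w b \<noteq> 0"
    if "generating_pair G a b" "class_weight w a = 0" for a b
  proof
    assume "class_weight w b = 0"
    moreover have "{a, b} \<subseteq> carrier G" "X \<in> generate G {a, b}"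
      using that(1) X(1) by (simp_all add: generating_pair_def)
    ultimately have "class_weight w X = 0"
      using that(2) int_hom_eq_0_on_generate [of "class_weight w" "{a, b}" X, OF hom] by blast
    with X(2) show False ..
  qed
  have "nielsen_equiv G [x, y] [x', y'] \<longleftrightarrow> twisted x y x' y'"
  proof
    assume "nielsen_equiv G [x, y] [x', y']"
    moreover have "x \<in> carrier G" "y \<in> carrier G"
      using assms(5) by (simp_all add: generating_pair_def)
    ultimately show "twisted x y x' y'"
      using nielsen_equiv_imp_twisted [of "class_weight w" x y x' y', OF hom] zero
        nonzero [OF assms(5)] nonzero [OF assms(6)] by blast
  next
    assume "twisted x y x' y'"
    then show "nielsen_equiv G [x, y] [x', y']"
      using assms(5) by (rule twisted_imp_nielsen_equiv)
  qed
  then show ?thesis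
    unfolding twisted_def .
qed

end
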